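(* If $X$ has countable extent and can be written as the union of finitely many $D$-spaces, then $X$ is linearly Lindelöf.
   Context: $X$ is a topological space, and the finitely many $D$-spaces are subspaces of $X$. A space $X$ has countable extent if every closed discrete subset of $X$ is countable. $X$ is linearly Lindelöf if every increasing open cover of $X$ (i.e. every open cover linearly ordered by inclusion) has a countable subcover. A neighborhood assignment on a space $Y$ is a family $\{N(y):y\in Y\}$ of subsets of $Y$ with $y\in \operatorname{Int} N(y)$ for each $y\in Y$. A space $Y$ is a $D$-space if for every neighborhood assignment $\{N(y):y\in Y\}$ on $Y$ there is a closed discrete subset $D$ of $Y$ such that $Y=\bigcup\{N(y):y\in D\}$.
   Formalization: X is assumed to be a T0 space; with no separation axiom the claim fails, e.g. for the product of an uncountable discrete space with a two-point indiscrete space, which is a union of two discrete subspaces. *)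

theory Defs
  imports "HOL-Analysis.Analysis"
begin

definition closed_discrete_in :: "'a topology \<Rightarrow> 'a set \<Rightarrow> bool" where
  "closed_discrete_in X S \<longleftrightarrow> closedin X S \<and> subtopology X S = discrete_topology S"

definition countable_extent :: "'a topology \<Rightarrow> bool" where
  "countable_extent X \<longleftrightarrow> (\<forall>S. closed_discrete_in X S \<longrightarrow> countable S)"

definition linearly_Lindelof_space :: "'a topology \<Rightarrow> bool" where
  "linearly_Lindelof_space X \<longleftrightarrow>
     (\<forall>\<U>. (\<forall>U\<in>\<U>. openin X U) \<and> \<Union>\<U> = topspace X \<and> chain\<^sub>\<subseteq> \<U>
        \<longrightarrow> (\<exists>\<V>. countable \<V> \<and> \<V> \<subseteq> \<U> \<and> \<Union>\<V> = topspace X))"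

definition neighborhood_assignment :: "'a topology \<Rightarrow> ('a \<Rightarrow> 'a set) \<Rightarrow> bool" where
  "neighborhood_assignment Y N \<longleftrightarrow>
     (\<forall>y\<in>topspace Y. N y \<subseteq> topspace Y \<and> y \<in> Y interior_of (N y))"

definition D_space :: "'a topology \<Rightarrow> bool" where
  "D_space Y \<longleftrightarrow>
     (\<forall>N. neighborhood_assignment Y N
        \<longrightarrow> (\<exists>D. closed_discrete_in Y D \<and> topspace Y = (\<Union>y\<in>D. N y)))"

end

theory Submission
  imports Defs
begin

text \<open>
  Why the theorem holds. In a chain of sets, well-ordering the chain and sending a point \<open>x\<close> to the
  first member \<open>m x\<close> that contains it gives an open assignment that is \<^emph>\<open>transitive\<close>:
  \<open>x \<in> m z\<close> implies \<open>m x \<subseteq> m z\<close> (lemma \<open>chain_transitive_choice\<close>). It suffices to cover the space by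
  countably many sets \<open>m c\<close>. Lemma \<open>transitive_assignment_countable_cover\<close> does this for every closed
  set \<open>F\<close> that lies in a union of finitely many \<open>D\<close>-subspaces, by induction on their number.

  Let \<open>Y\<close> be one of the subspaces. As \<open>Y\<close> is a \<open>D\<close>-space, \<open>F \<inter> Y\<close> is covered by the sets \<open>m d\<close> with
  \<open>d\<close> in some \<open>D \<subseteq> F \<inter> Y\<close> that is closed and discrete in \<open>Y\<close>. Choose open sets \<open>G d\<close> with
  \<open>G d \<inter> D = {d}\<close>. Inside the closure of \<open>D\<close> in \<open>X\<close>, the set \<open>G d\<close> lies in the closure of \<open>d\<close>, and
  therefore the sets \<open>G d\<close> are disjoint there. What remains of the closure outside all \<open>G d\<close> is closed
  and misses \<open>Y\<close>, so by induction some countable union \<open>O\<close> of sets \<open>m c\<close> covers it. Outside \<open>O\<close> the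
  closure of \<open>D\<close> is a closed set split into disjoint relatively clopen pieces. Picking a closed point in
  each nonempty piece yields a closed discrete set of \<open>X\<close>; by countable extent there are only countably
  many pieces, so \<open>D - O\<close> is countable. By transitivity the points of \<open>D \<inter> O\<close> contribute nothing
  outside \<open>O\<close>, so countably many sets \<open>m c\<close> cover \<open>F \<inter> Y\<close>, and the induction hypothesis covers the
  rest of \<open>F\<close>.

  Points of \<open>X\<close> need not be closed. The \<open>T\<^sub>0\<close> axiom enters only through lemma \<open>closed_point_exists\<close>,
  which supplies the closed points used above. Without it the theorem fails: the product of an
  uncountable discrete space and a two-point indiscrete space is the union of two discrete subspaces,
  and its only closed discrete subset is empty.
\<close>

section \<open>Closed discrete sets\<close>

lemma closed_discrete_in_iff_closed_subsets:
  "closed_discrete_in X S \<longleftrightarrow> (\<forall>T\<subseteq>S. closedin X T)"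
proof
  assume S: "closed_discrete_in X S"
  show "\<forall>T\<subseteq>S. closedin X T"
  proof (intro allI impI)
    fix T assume "T \<subseteq> S"
    then have "closedin (subtopology X S) T"
      using S by (simp add: closed_discrete_in_def)
    then show "closedin X T"
      using S closedin_trans_full unfolding closed_discrete_in_def by blast
  qed
next
  assume S: "\<forall>T\<subseteq>S. closedin X T"
  then have SX: "S \<subseteq> topspace X"
    using closedin_subset by blast
  have "openin (subtopology X S) T" if "T \<subseteq> S" for T
  proof -
    have "closedin X (S - T)"
      using S by blast
    then have "closedin (subtopology X S) (S - T)"
      using closedin_subset_topspace by blast
    moreover have "topspace (subtopology X S) - (S - T) = T"
      using that SX by auto
    ultimately show ?thesis
      by (metis openin_diff openin_topspace)
  qed
  then have "discrete_topology S = subtopology X S"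
    using SX by (auto simp: discrete_topology_unique)
  moreover have "closedin X S"
    using S by blast
  ultimately show "closed_discrete_in X S"
    unfolding closed_discrete_in_def by simp
qed

text \<open>
  One point from each piece of a disjoint relatively open partition of \<open>K\<close> forms a closed discrete
  set, as long as the chosen points are closed.
\<close>

lemma countable_disjoint_open_pieces:
  assumes ext: "countable_extent X"
    and K: "closedin X K"
    and G: "\<And>d. d \<in> I \<Longrightarrow> openin X (G d)"
    and cov: "K \<subseteq> (\<Union>d\<in>I. G d)"
    and disj: "\<And>d e. \<lbrakk>d \<in> I; e \<in> I; G d \<inter> G e \<inter> K \<noteq> {}\<rbrakk> \<Longrightarrow> d = e"
    and pts: "\<And>C. \<lbrakk>closedin X C; C \<subseteq> K; C \<noteq> {}\<rbrakk> \<Longrightarrow> \<exists>p\<in>C. closedin X {p}"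
  shows "countable {d \<in> I. G d \<inter> K \<noteq> {}}"
proof -
  define J where "J = {d \<in> I. G d \<inter> K \<noteq> {}}"
  have "\<exists>p \<in> G d \<inter> K. closedin X {p}" if d: "d \<in> J" for d
  proof -
    have "G d \<inter> K = K - (\<Union>e\<in>I - {d}. G e)"
      using cov disj d unfolding J_def by blast
    moreover have "openin X (\<Union>e\<in>I - {d}. G e)"
      using G by blast
    ultimately have "closedin X (G d \<inter> K)"
      using K by (simp add: closedin_diff)
    then show ?thesis
      using pts[of "G d \<inter> K"] d unfolding J_def by blast
  qed
  then obtain p where p: "\<And>d. d \<in> J \<Longrightarrow> p d \<in> G d \<inter> K \<and> closedin X {p d}"
    by metis
  have peq: "p e = p d" if "e \<in> J" "d \<in> I" "p e \<in> G d" for d e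
    using disj[of d e] p[of e] that unfolding J_def by blast
  have "closedin X Q" if Q: "Q \<subseteq> p ` J" for Q
  proof -
    \<comment> \<open>Each piece without its chosen point, when that point is in \<open>Q\<close>: these open sets cover \<open>K - Q\<close>
      and miss \<open>Q\<close>, so \<open>Q\<close> is closed.\<close>
    define H where "H d = G d - (if d \<in> J then {p d} \<inter> Q else {})" for d
    have H: "openin X (H d)" if "d \<in> I" for d
      using that G p unfolding H_def by (cases "d \<in> J \<and> p d \<in> Q") (auto intro: openin_diff)
    have QK: "Q \<subseteq> K"
      using Q p by blast
    have KH: "K - (\<Union>d\<in>I. H d) = Q"
    proof
      show "K - (\<Union>d\<in>I. H d) \<subseteq> Q"
        using cov unfolding H_def by (fastforce split: if_splits)
      have "q \<notin> H d" if q: "q \<in> Q" and d: "d \<in> I" for q d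
      proof
        assume qH: "q \<in> H d"
        obtain e where e: "e \<in> J" "q = p e"
          using Q q by blast
        have qG: "q \<in> G d"
          using qH unfolding H_def by blast
        then have "d \<in> J"
          using d q QK unfolding J_def by blast
        moreover have "q = p d"
          using peq[OF e(1) d] e qG by simp
        ultimately show False
          using qH q unfolding H_def by simp
      qed
      then show "Q \<subseteq> K - (\<Union>d\<in>I. H d)"
        using QK by blast
    qed
    have "openin X (\<Union>d\<in>I. H d)"
      using H by blast
    then show ?thesis
      using K KH closedin_diff by metis
  qed
  then have "countable (p ` J)"
    using ext by (simp add: closed_discrete_in_iff_closed_subsets countable_extent_def)
  moreover have "inj_on p J"
  proof (rule inj_onI)
    fix d e assume "d \<in> J" "e \<in> J" "p d = p e"
    then show "d = e"
      using disj[of d e] p[of d] p[of e] unfolding J_def by auto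
  qed
  ultimately show ?thesis
    unfolding J_def using countable_image_inj_on by blast
qed

section \<open>Closed parts of D-subspaces\<close>

text \<open>
  The \<open>D\<close>-property is inherited by the closed part \<open>F \<inter> Y\<close>: give the points outside \<open>F\<close> neighbourhoods
  that avoid \<open>F\<close>, so that they cannot help to cover it.
\<close>

lemma D_space_closed_part:
  assumes D: "D_space (subtopology X Y)"
    and F: "closedin X F"
    and N: "\<And>y. y \<in> F \<inter> Y \<Longrightarrow> openin X (N y) \<and> y \<in> N y"
  obtains D where "D \<subseteq> F \<inter> Y" "closed_discrete_in (subtopology X Y) D" "F \<inter> Y \<subseteq> (\<Union>d\<in>D. N d)"
proof -
  have YX: "topspace (subtopology X Y) = topspace X \<inter> Y"
    by simp
  define M where "M y = topspace X \<inter> Y \<inter> (if y \<in> F then N y else - F)" for y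
  have "neighborhood_assignment (subtopology X Y) M"
    unfolding neighborhood_assignment_def
  proof (intro ballI conjI)
    fix y assume y: "y \<in> topspace (subtopology X Y)"
    show "M y \<subseteq> topspace (subtopology X Y)"
      unfolding M_def by auto
    have "openin (subtopology X Y) (M y)"
    proof (cases "y \<in> F")
      case True
      then have "openin X (N y)"
        using N y by auto
      moreover have "M y = Y \<inter> N y"
        using True openin_subset[OF calculation] unfolding M_def by auto
      ultimately show ?thesis
        by (simp add: openin_subtopology_Int2)
    next
      case False
      then have "M y = Y \<inter> (topspace X - F)"
        unfolding M_def by auto
      then show ?thesis
        using F by (simp add: openin_subtopology_Int2 openin_diff)
    qed
    moreover have "y \<in> M y"
      using y N unfolding M_def by auto
    ultimately show "y \<in> subtopology X Y interior_of M y"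
      by (simp add: interior_of_openin)
  qed
  then obtain E where E: "closed_discrete_in (subtopology X Y) E"
    and cov: "topspace (subtopology X Y) = (\<Union>y\<in>E. M y)"
    using D unfolding D_space_def by blast
  have EY: "E \<subseteq> topspace X \<inter> Y"
    using E closedin_subset unfolding closed_discrete_in_def by fastforce
  have "F \<inter> Y \<subseteq> (\<Union>d\<in>E \<inter> F. N d)"
  proof
    fix x assume x: "x \<in> F \<inter> Y"
    then have "x \<in> topspace (subtopology X Y)"
      using closedin_subset[OF F] by auto
    then obtain d where "d \<in> E" "x \<in> M d"
      using cov by blast
    then show "x \<in> (\<Union>d\<in>E \<inter> F. N d)"
      using x unfolding M_def by (auto split: if_splits)
  qed
  moreover have "closed_discrete_in (subtopology X Y) (E \<inter> F)"
    using E unfolding closed_discrete_in_iff_closed_subsets by blast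
  ultimately show thesis
    using that[of "E \<inter> F"] EY by blast
qed

lemma closure_of_Int_closedin_subtopology:
  assumes "closedin (subtopology X Y) S"
  shows "X closure_of S \<inter> Y = S"
proof -
  have "S \<subseteq> Y"
    using closedin_subset[OF assms] by simp
  moreover have "subtopology X Y closure_of S = S"
    using assms by (simp add: closure_of_eq)
  ultimately show ?thesis
    by (simp add: closure_of_subtopology Int_commute inf.absorb_iff2)
qed

text \<open>
  A point that is closed in \<open>Y\<close> is either closed in the whole space or has another point \<open>z\<close> in its
  closure. In the second case the \<open>T\<^sub>0\<close> axiom keeps \<open>y\<close> out of the closure of \<open>z\<close>, so this closure misses
  \<open>Y\<close> and the search continues there with one subspace less.
\<close>

lemma closed_point_exists:
  assumes T0: "t0_space X" and "finite \<Y>"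
    and "\<And>Y. Y \<in> \<Y> \<Longrightarrow> D_space (subtopology X Y)"
    and "closedin X F" "F \<noteq> {}" "F \<subseteq> \<Union>\<Y>"
  shows "\<exists>p\<in>F. closedin X {p}"
  using assms(2-)
proof (induction \<Y> arbitrary: F rule: finite_induct)
  case empty
  then show ?case by auto
next
  case (insert Y \<Y>)
  note IH = insert.IH[OF insert.prems(1)]
  have FX: "F \<subseteq> topspace X"
    using insert.prems(2) closedin_subset by blast
  show ?case
  proof (cases "F \<inter> Y = {}")
    case True
    then have "F \<subseteq> \<Union>\<Y>"
      using insert.prems(4) by blast
    then show ?thesis
      using IH insert.prems(2,3) by blast
  next
    case False
    obtain D where D: "D \<subseteq> F \<inter> Y" "closed_discrete_in (subtopology X Y) D"
      "F \<inter> Y \<subseteq> (\<Union>d\<in>D. topspace X)"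
      using D_space_closed_part[of X Y F "\<lambda>_. topspace X"] insert.prems(1,2) FX
      by (metis IntD1 in_mono insertI1 openin_topspace)
    then obtain y where y: "y \<in> D"
      using False by blast
    then have "closedin (subtopology X Y) {y}"
      using D(2) unfolding closed_discrete_in_iff_closed_subsets by blast
    then have clY: "X closure_of {y} \<inter> Y = {y}"
      by (rule closure_of_Int_closedin_subtopology)
    have yF: "y \<in> F" using D(1) y by blast
    have clF: "X closure_of {y} \<subseteq> F"
      using yF insert.prems(2) by (simp add: closure_of_minimal)
    show ?thesis
    proof (cases "X closure_of {y} = {y}")
      case True
      then show ?thesis
        using yF closedin_closure_of by metis
    next
      case False
      then obtain z where z: "z \<in> X closure_of {y}" "z \<noteq> y"
        using clY by blast
      have zX: "z \<in> topspace X"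
        using z clF FX by blast
      have sub: "X closure_of {z} \<subseteq> X closure_of {y}"
        using z by (simp add: closure_of_minimal)
      have "y \<notin> X closure_of {z}"
      proof
        assume "y \<in> X closure_of {z}"
        then have "X closure_of {y} = X closure_of {z}"
          using sub by (simp add: closure_of_minimal subset_antisym)
        then show False
          using T0 z(2) zX yF FX unfolding t0_space_closure_of_sing by blast
      qed
      then have "X closure_of {z} \<inter> Y = {}"
        using sub clY by auto
      then have "X closure_of {z} \<subseteq> \<Union>\<Y>"
        using sub clF insert.prems(4) by blast
      moreover have "X closure_of {z} \<noteq> {}"
        using zX by (simp add: closure_of_eq_empty_gen)
      ultimately obtain p where "p \<in> X closure_of {z}" "closedin X {p}"
        using IH[of "X closure_of {z}"] insert.prems(1) by auto
      then show ?thesis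
        using sub clF by blast
    qed
  qed
qed

section \<open>Transitive open assignments\<close>

lemma chain_transitive_choice:
  assumes "chain\<^sub>\<subseteq> \<U>"
  obtains m where "\<And>x. x \<in> \<Union>\<U> \<Longrightarrow> m x \<in> \<U> \<and> x \<in> m x"
    and "\<And>x z. \<lbrakk>z \<in> \<Union>\<U>; x \<in> m z\<rbrakk> \<Longrightarrow> m x \<subseteq> m z"
proof -
  obtain r :: "'a set rel" where r: "well_order_on UNIV r"
    using well_order_on by blast
  then have wf: "wf (r - Id)" and tot: "total r"
    by (simp_all add: well_order_on_def linear_order_on_def)
  \<comment> \<open>\<open>m x\<close> is the first member of the chain that contains \<open>x\<close>, in an arbitrary well-order.\<close>
  have "\<exists>U. U \<in> \<U> \<and> x \<in> U \<and> (\<forall>V\<in>\<U>. x \<in> V \<longrightarrow> (V, U) \<notin> r - Id)" if x: "x \<in> \<Union>\<U>" for x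
  proof -
    have "{U \<in> \<U>. x \<in> U} \<noteq> {}"
      using x by blast
    from wfE_min'[OF wf this] show ?thesis
      by (metis (mono_tags, lifting) mem_Collect_eq)
  qed
  then obtain m where m: "\<And>x. x \<in> \<Union>\<U> \<Longrightarrow> m x \<in> \<U> \<and> x \<in> m x"
    and first: "\<And>x V. \<lbrakk>x \<in> \<Union>\<U>; V \<in> \<U>; x \<in> V\<rbrakk> \<Longrightarrow> (V, m x) \<notin> r - Id"
    by metis
  have "m x \<subseteq> m z" if z: "z \<in> \<Union>\<U>" and x: "x \<in> m z" for x z
  proof (rule ccontr)
    assume not: "\<not> m x \<subseteq> m z"
    have xU: "x \<in> \<Union>\<U>"
      using m[OF z] x by blast
    have "m z \<subseteq> m x"
      using assms not m[OF z] m[OF xU] unfolding chain_subset_def by blast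
    then have "(m x, m z) \<notin> r - Id"
      using first[OF z] m[OF z] m[OF xU] by blast
    moreover have "(m z, m x) \<notin> r - Id"
      using first[OF xU] m[OF z] x by blast
    ultimately show False
      using tot not unfolding total_on_def by blast
  qed
  with m show thesis
    by (rule that)
qed

text \<open>
  The induction hypothesis is used twice: on the part of the closure of \<open>D\<close> that the isolating sets
  \<open>G d\<close> do not reach, and on the part of \<open>F\<close> that is left once \<open>F \<inter> Y\<close> is covered. Both are closed
  and disjoint from \<open>Y\<close>.
\<close>

lemma transitive_assignment_countable_cover:
  assumes T0: "t0_space X" and ext: "countable_extent X"
    and fin: "finite \<Y>"
    and D: "\<And>Y. Y \<in> \<Y> \<Longrightarrow> D_space (subtopology X Y)"
    and cov: "topspace X \<subseteq> \<Union>\<Y>"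
    and m: "\<And>x. x \<in> topspace X \<Longrightarrow> openin X (m x) \<and> x \<in> m x"
    and trans: "\<And>x z. \<lbrakk>z \<in> topspace X; x \<in> m z\<rbrakk> \<Longrightarrow> m x \<subseteq> m z"
  shows "\<exists>C. countable C \<and> C \<subseteq> topspace X \<and> topspace X \<subseteq> (\<Union>c\<in>C. m c)"
proof -
  have point: "\<exists>p\<in>C. closedin X {p}" if "closedin X C" "C \<noteq> {}" for C
    using closed_point_exists[OF T0 fin D that] closedin_subset[OF that(1)] cov by blast
  have "\<exists>C. countable C \<and> C \<subseteq> topspace X \<and> F \<subseteq> (\<Union>c\<in>C. m c)"
    if "finite \<Z>" "\<Z> \<subseteq> \<Y>" "closedin X F" "F \<subseteq> \<Union>\<Z>" for \<Z> F
    using that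
  proof (induction \<Z> arbitrary: F rule: finite_induct)
    case empty
    then show ?case by auto
  next
    case (insert Y \<Z>)
    have IH: "\<exists>C. countable C \<and> C \<subseteq> topspace X \<and> F' \<subseteq> (\<Union>c\<in>C. m c)"
      if "closedin X F'" "F' \<subseteq> F" "F' \<inter> Y = {}" for F'
    proof (rule insert.IH)
      show "F' \<subseteq> \<Union>\<Z>"
        using that insert.prems(3) by blast
    qed (use that insert.prems in auto)
    have FX: "F \<subseteq> topspace X"
      using insert.prems(2) closedin_subset by blast
    obtain D where DF: "D \<subseteq> F \<inter> Y" and Dcd: "closed_discrete_in (subtopology X Y) D"
      and Dcov: "F \<inter> Y \<subseteq> (\<Union>d\<in>D. m d)"
      using D_space_closed_part[of X Y F m] D[of Y] m insert.prems(1,2) FX by blast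
    define K where "K = X closure_of D"
    have DX: "D \<subseteq> F" "D \<subseteq> topspace X"
      using DF FX by auto
    have K: "closedin X K" "K \<subseteq> F" "D \<subseteq> K"
      unfolding K_def
      by (simp_all add: DX insert.prems(2) closure_of_minimal closure_of_subset)
    have KY: "K \<inter> Y = D"
      using closure_of_Int_closedin_subtopology Dcd
      unfolding K_def closed_discrete_in_def by blast
    have "\<exists>G. openin X G \<and> G \<inter> D = {d}" if d: "d \<in> D" for d
    proof -
      \<comment> \<open>As \<open>D - {d}\<close> is closed in \<open>Y\<close>, its closure in \<open>X\<close> leaves out \<open>d\<close>; \<open>G\<close> is the complement.\<close>
      have "closedin (subtopology X Y) (D - {d})"
        using Dcd unfolding closed_discrete_in_iff_closed_subsets by blast
      then have "X closure_of (D - {d}) \<inter> Y = D - {d}"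
        by (rule closure_of_Int_closedin_subtopology)
      then have "(topspace X - X closure_of (D - {d})) \<inter> D = {d}"
        using DF FX d by blast
      then show ?thesis
        by (metis closedin_closure_of openin_diff openin_topspace)
    qed
    then obtain G where G: "\<And>d. d \<in> D \<Longrightarrow> openin X (G d) \<and> G d \<inter> D = {d}"
      by metis
    have GK: "G d \<inter> K \<subseteq> X closure_of {d}" if "d \<in> D" for d
      using openin_Int_closure_of_subset[of X "G d" D] G[OF that] unfolding K_def by simp
    \<comment> \<open>A common point is in the closure of \<open>e\<close> and in the open set \<open>G d\<close>, so \<open>e\<close> is in \<open>G d\<close> too.\<close>
    have disj: "d = e" if d: "d \<in> D" and e: "e \<in> D" and meet: "G d \<inter> G e \<inter> K \<noteq> {}" for d e
    proof -
      obtain x where "x \<in> G d" "x \<in> X closure_of {e}"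
        using meet GK[OF e] by blast
      then have "e \<in> G d"
        using G[OF d] by (auto simp: in_closure_of)
      then show ?thesis
        using G[OF d] e by auto
    qed
    have "openin X (\<Union>d\<in>D. G d)"
      using G by blast
    then have "closedin X (K - (\<Union>d\<in>D. G d))"
      using K by (simp add: closedin_diff)
    moreover have "(K - (\<Union>d\<in>D. G d)) \<inter> Y = {}"
      using KY G by blast
    ultimately have "\<exists>A. countable A \<and> A \<subseteq> topspace X \<and> K - (\<Union>d\<in>D. G d) \<subseteq> (\<Union>c\<in>A. m c)"
      using K(2) by (intro IH) auto
    then obtain A where A: "countable A" "A \<subseteq> topspace X"
      "K - (\<Union>d\<in>D. G d) \<subseteq> (\<Union>c\<in>A. m c)"
      by (elim exE conjE)
    define O' where "O' = (\<Union>c\<in>A. m c)"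
    have "openin X O'"
      using A(2) m unfolding O'_def by blast
    then have "closedin X (K - O')"
      using K by (simp add: closedin_diff)
    then have "countable {d \<in> D. G d \<inter> (K - O') \<noteq> {}}"
    proof (rule countable_disjoint_open_pieces[OF ext])
      show "K - O' \<subseteq> (\<Union>d\<in>D. G d)"
        using A(3) unfolding O'_def by blast
      show "d = e" if "d \<in> D" "e \<in> D" "G d \<inter> G e \<inter> (K - O') \<noteq> {}" for d e
        using disj that by blast
    qed (use G point in auto)
    moreover have "D - O' \<subseteq> {d \<in> D. G d \<inter> (K - O') \<noteq> {}}"
      using G K(3) by blast
    ultimately have DO: "countable (D - O')"
      using countable_subset by blast
    define B where "B = A \<union> (D - O')"
    have B: "countable B" "B \<subseteq> topspace X"
      using A DO DF FX unfolding B_def by auto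
    have BY: "F \<inter> Y \<subseteq> (\<Union>c\<in>B. m c)"
    proof
      fix x assume "x \<in> F \<inter> Y"
      then obtain d where d: "d \<in> D" "x \<in> m d"
        using Dcov by blast
      show "x \<in> (\<Union>c\<in>B. m c)"
      proof (cases "d \<in> O'")
        case True
        then obtain c where "c \<in> A" "d \<in> m c"
          unfolding O'_def by blast
        then have "x \<in> m c"
          using trans[of c d] A(2) d(2) by blast
        then show ?thesis
          using \<open>c \<in> A\<close> unfolding B_def by blast
      next
        case False
        then show ?thesis
          using d unfolding B_def by blast
      qed
    qed
    have "openin X (\<Union>c\<in>B. m c)"
      using B m by blast
    then have "closedin X (F - (\<Union>c\<in>B. m c))"
      using insert.prems(2) by (simp add: closedin_diff)
    then have "\<exists>C. countable C \<and> C \<subseteq> topspace X \<and> F - (\<Union>c\<in>B. m c) \<subseteq> (\<Union>c\<in>C. m c)"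
      using BY by (intro IH) auto
    then obtain C where "countable C" "C \<subseteq> topspace X" "F - (\<Union>c\<in>B. m c) \<subseteq> (\<Union>c\<in>C. m c)"
      by (elim exE conjE)
    then show ?case
      using B by (intro exI[of _ "B \<union> C"]) auto
  qed
  from this[OF fin subset_refl closedin_topspace cov] show ?thesis .
qed

theorem theorem4p2:
  fixes X :: "'a topology" and \<Y> :: "'a set set"
  assumes "t0_space X"
    and "countable_extent X"
    and "finite \<Y>"
    and "\<And>Y. Y \<in> \<Y> \<Longrightarrow> Y \<subseteq> topspace X"
    and "\<And>Y. Y \<in> \<Y> \<Longrightarrow> D_space (subtopology X Y)"
    and "topspace X = \<Union>\<Y>"
  shows "linearly_Lindelof_space X"
  unfolding linearly_Lindelof_space_def
proof (intro allI impI)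
  fix \<U> assume U: "(\<forall>U\<in>\<U>. openin X U) \<and> \<Union>\<U> = topspace X \<and> chain\<^sub>\<subseteq> \<U>"
  then obtain m where m: "\<And>x. x \<in> topspace X \<Longrightarrow> m x \<in> \<U> \<and> x \<in> m x"
    and trans: "\<And>x z. \<lbrakk>z \<in> topspace X; x \<in> m z\<rbrakk> \<Longrightarrow> m x \<subseteq> m z"
    using chain_transitive_choice[of \<U>] by metis
  have "openin X (m x) \<and> x \<in> m x" if "x \<in> topspace X" for x
    using m[OF that] U by blast
  from transitive_assignment_countable_cover[OF assms(1-3,5) equalityD1[OF assms(6)] this trans]
  obtain C where C: "countable C" "C \<subseteq> topspace X" "topspace X \<subseteq> (\<Union>c\<in>C. m c)"
    by auto
  have "countable (m ` C)" "m ` C \<subseteq> \<U>"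
    using C m by auto
  moreover have "\<Union>(m ` C) = topspace X"
    using C(3) U \<open>m ` C \<subseteq> \<U>\<close> by blast
  ultimately show "\<exists>\<V>. countable \<V> \<and> \<V> \<subseteq> \<U> \<and> \<Union>\<V> = topspace X"
    by blast
qed

end
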